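(* Let $\lambda,\varkappa$ be infinite cardinals with $\lambda<\varkappa$, and let $\{H_\alpha:\alpha<\varkappa\}$ be a family of groups such that $|H_\alpha|\le\lambda$ for each $\alpha<\varkappa$. Let $G$ be a subgroup of the direct product $H=\otimes_{\alpha<\varkappa}H_\alpha$ such that $|G|=\varkappa$. Then there exists a partition $G=\bigcup_{n<\omega}A_n$ of $G$ into countably many cells such that $cov(A_nA_n^{-1})=\varkappa$ for each $n\in\omega$.
   Context: For a group $G$ and a (nonempty) subset $A\subseteq G$, $cov(A)=\min\{|X| : X\subseteq G,\ G=XA\}$, where $XA=\{xa : x\in X,\ a\in A\}$; also $AA^{-1}=\{ab^{-1} : a,b\in A\}$. The direct product $\otimes_{\alpha<\varkappa}H_\alpha$ is the restricted direct product (direct sum): the group of all families $(h_\alpha)_{\alpha<\varkappa}$ with $h_\alpha\in H_\alpha$ and $h_\alpha=e_\alpha$ (the identity of $H_\alpha$) for all but finitely many $\alpha$, with coordinatewise multiplication. $\omega=\{0,1,2,\dots\}$. A partition $G=\bigcup_{n<\omega}A_n$ means that the cells $A_n$ are nonempty, pairwise disjoint, and have union $G$. *)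

theory Defs
  imports
    Main
    "HOL-Library.Disjoint_Sets"
    "HOL-Algebra.Coset"
    "HOL-Algebra.Product_Groups"
begin

unbundle cardinal_syntax

text \<open>Cardinals are relations \<open>r\<close> with \<open>Card_order r\<close>, compared up to \<open>=o\<close>.
  The minimum of a nonempty class of cardinals exists and is unique up to \<open>=o\<close>;
  \<open>cov\<close> picks a representative of it (see \<open>cov_is_min\<close> below).\<close>

definition covers :: "('a, 'm) monoid_scheme \<Rightarrow> 'a set \<Rightarrow> 'a set \<Rightarrow> bool"
  where "covers G A X \<longleftrightarrow> X \<subseteq> carrier G \<and> carrier G = X <#>\<^bsub>G\<^esub> A"

definition cov :: "('a, 'm) monoid_scheme \<Rightarrow> 'a set \<Rightarrow> 'a rel"
  where "cov G A = (SOME r. r \<in> {|X| | X. covers G A X} \<and>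
                             (\<forall>r' \<in> {|X| | X. covers G A X}. r \<le>o r'))"

lemma covers_carrier:
  assumes "group G" "A \<subseteq> carrier G" "A \<noteq> {}"
  shows "covers G A (carrier G)"
proof -
  interpret group G by fact
  obtain a where a: "a \<in> A" "a \<in> carrier G" using assms by blast
  have "g \<in> carrier G <#>\<^bsub>G\<^esub> A" if "g \<in> carrier G" for g
  proof -
    have "g = (g \<otimes>\<^bsub>G\<^esub> inv\<^bsub>G\<^esub> a) \<otimes>\<^bsub>G\<^esub> a"
      using that a by (simp add: m_assoc)
    then show ?thesis
      unfolding set_mult_def using that a by blast
  qed
  then show ?thesis
    using assms set_mult_closed[of "carrier G" A] by (auto simp: covers_def)
qed

lemma cov_is_min:
  assumes "group G" "A \<subseteq> carrier G" "A \<noteq> {}"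
  shows "\<exists>X. covers G A X \<and> cov G A = |X|"
    and "covers G A Y \<Longrightarrow> cov G A \<le>o |Y|"
proof -
  let ?R = "{|X| | X. covers G A X}"
  have "?R \<noteq> {}" using covers_carrier[OF assms] by blast
  moreover have "\<forall>r\<in>?R. Card_order r" by (auto simp: card_of_Card_order)
  ultimately have "\<exists>r. r \<in> ?R \<and> (\<forall>r'\<in>?R. r \<le>o r')"
    using exists_minim_Card_order[of ?R] by blast
  then have *: "cov G A \<in> ?R \<and> (\<forall>r'\<in>?R. cov G A \<le>o r')"
    unfolding cov_def by (rule someI_ex)
  then show "\<exists>X. covers G A X \<and> cov G A = |X|" by blast
  show "covers G A Y \<Longrightarrow> cov G A \<le>o |Y|" using * by blast
qed

end

theory Submission
  imports Defs "HOL-Algebra.Free_Abelian_Groups"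
begin

text \<open>
  The cells of the partition collect the elements of \<open>G\<close> according to the size of their
  support, the finite set of coordinates at which they differ from the identity. If all
  elements of \<open>A\<close> have support of size \<open>m\<close>, then every element of \<open>A A\<inverse>\<close> has support of size at
  most \<open>2 m\<close>. Suppose \<open>G = X A A\<inverse>\<close> with \<open>|X| < \<kappa>\<close>, and let \<open>U\<close> be the union of the supports of the
  elements of \<open>X\<close>. Then \<open>|U| < \<kappa>\<close>, and any element of \<open>G\<close> whose support avoids \<open>U\<close> has support
  of size at most \<open>2 m\<close>: multiplying by an element of \<open>X\<close> cannot change it outside \<open>U\<close>.

  So it suffices to find, for every small set \<open>U\<close> of coordinates, elements of \<open>G\<close> with
  arbitrarily large support avoiding \<open>U\<close> (\<open>subgroup_large_supp_avoiding\<close>). One nontrivial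
  element avoiding \<open>U\<close> is found by counting: the direct sum over \<open>U\<close> has fewer than
  \<open>\<kappa>\<close> elements (\<open>card_supported_elements\<close>), so two distinct elements of \<open>G\<close> agree on \<open>U\<close>,
  and their quotient is nontrivial with support avoiding \<open>U\<close> (\<open>subgroup_nontrivial_avoiding\<close>).
  Adding this finite support to \<open>U\<close> and iterating yields elements with pairwise disjoint
  supports, in whose products nothing cancels.

  The case \<open>U = {}\<close> shows that infinitely many support sizes occur in \<open>G\<close>. A size that does not
  occur would give an empty cell, so the cells are indexed by the increasing enumeration of the
  sizes that do occur.
\<close>

section \<open>Supports in a direct sum of groups\<close>

definition supp :: "'i set \<Rightarrow> ('i \<Rightarrow> ('h, 'm) monoid_scheme) \<Rightarrow> ('i \<Rightarrow> 'h) \<Rightarrow> 'i set"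
  where "supp I H x = {i \<in> I. x i \<noteq> \<one>\<^bsub>H i\<^esub>}"

lemma finite_supp:
  assumes "\<And>i. i \<in> I \<Longrightarrow> group (H i)" "x \<in> carrier (sum_group I H)"
  shows "finite (supp I H x)"
  using assms(2) by (simp add: supp_def carrier_sum_group[OF assms(1)])

lemma sum_group_nth_closed:
  assumes "\<And>i. i \<in> I \<Longrightarrow> group (H i)" "x \<in> carrier (sum_group I H)" "i \<in> I"
  shows "x i \<in> carrier (H i)"
  using assms(2,3) by (auto simp: carrier_sum_group[OF assms(1)])

lemma sum_group_eqI:
  assumes "\<And>i. i \<in> I \<Longrightarrow> group (H i)"
    and "x \<in> carrier (sum_group I H)" "y \<in> carrier (sum_group I H)"
    and "\<And>i. i \<in> I \<Longrightarrow> x i = y i"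
  shows "x = y"
  using assms(2-4) by (auto simp: carrier_sum_group[OF assms(1)] intro: PiE_ext)

lemma supp_mult_subset:
  assumes "\<And>i. i \<in> I \<Longrightarrow> group (H i)"
  shows "supp I H (x \<otimes>\<^bsub>sum_group I H\<^esub> y) \<subseteq> supp I H x \<union> supp I H y"
  using group.is_monoid[OF assms] by (auto simp: supp_def)

lemma supp_mult_disjoint:
  assumes grp: "\<And>i. i \<in> I \<Longrightarrow> group (H i)"
    and x: "x \<in> carrier (sum_group I H)" and y: "y \<in> carrier (sum_group I H)"
    and disj: "supp I H x \<inter> supp I H y = {}"
  shows "supp I H (x \<otimes>\<^bsub>sum_group I H\<^esub> y) = supp I H x \<union> supp I H y"
proof
  show "supp I H x \<union> supp I H y \<subseteq> supp I H (x \<otimes>\<^bsub>sum_group I H\<^esub> y)"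
  proof
    fix i assume i: "i \<in> supp I H x \<union> supp I H y"
    then have iI: "i \<in> I" by (auto simp: supp_def)
    interpret Hi: group "H i" by (rule grp[OF iI])
    note closed = sum_group_nth_closed[OF grp x iI] sum_group_nth_closed[OF grp y iI]
    show "i \<in> supp I H (x \<otimes>\<^bsub>sum_group I H\<^esub> y)"
      using i disj iI closed by (auto simp: supp_def)
  qed
qed (rule supp_mult_subset[of I H, OF grp])

lemma supp_inv:
  assumes "\<And>i. i \<in> I \<Longrightarrow> group (H i)" "x \<in> carrier (sum_group I H)"
  shows "supp I H (inv\<^bsub>sum_group I H\<^esub> x) = supp I H x"
  using sum_group_nth_closed[OF assms]
  by (auto simp: supp_def inv_sum_group[OF assms] group.inv_eq_1_iff[OF assms(1)])

section \<open>Subgroups that are large compared with a set of coordinates\<close>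

lemma finite_ordLeq_Cinfinite:
  assumes "finite A" "Cinfinite r"
  shows "|A| \<le>o r"
  using assms
  by (auto intro!: ordLess_imp_ordLeq Cfinite_ordLess_Cinfinite
      simp: cfinite_def card_of_Card_order Field_card_of)

text \<open>An element of the direct sum is determined by the finite graph of its restriction to its
  support, so there are no more such elements than finite sets of pairs \<open>(i, h)\<close> with \<open>i \<in> U\<close>
  and \<open>h \<in> H\<^sub>i\<close>.\<close>

lemma card_supported_elements:
  assumes grp: "\<And>i. i \<in> I \<Longrightarrow> group (H i)"
    and r: "Cinfinite r" and U: "|U| \<le>o r" "U \<subseteq> I"
    and H: "\<And>i. i \<in> U \<Longrightarrow> |carrier (H i)| \<le>o r"
  shows "|{x \<in> carrier (sum_group I H). supp I H x \<subseteq> U}| \<le>o r" (is "|?D| \<le>o r")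
proof -
  let ?T = "SIGMA i:U. carrier (H i)"
  let ?graph = "\<lambda>x. (\<lambda>i. (i, x i)) ` supp I H x"
  have T: "|?T| \<le>o r"
    using card_of_Sigma_ordLeq_infinite_Field[of r U "\<lambda>i. carrier (H i)"] r U H
    by (auto simp: cinfinite_def)
  have Fpow: "|Fpow ?T| \<le>o r"
  proof (cases "finite ?T")
    case True
    then have "finite (Fpow ?T)" by (simp add: Fpow_Pow_finite)
    then show ?thesis using r by (rule finite_ordLeq_Cinfinite)
  next
    case False
    from ordIso_ordLeq_trans[OF card_of_Fpow_infinite[OF this] T] show ?thesis .
  qed
  have inj: "inj_on ?graph ?D"
  proof (rule inj_onI)
    fix x y assume xy: "x \<in> ?D" "y \<in> ?D" and eq: "?graph x = ?graph y"
    have iff: "i \<in> supp I H x \<and> x i = h \<longleftrightarrow> i \<in> supp I H y \<and> y i = h" for i h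
    proof -
      have "(i, h) \<in> ?graph x \<longleftrightarrow> (i, h) \<in> ?graph y" by (simp only: eq)
      then show ?thesis by auto
    qed
    show "x = y"
    proof (rule sum_group_eqI[OF grp])
      fix i assume "i \<in> I"
      then show "x i = y i"
        using iff[of i "x i"] iff[of i "y i"] unfolding supp_def by auto
    qed (use xy in auto)
  qed
  have "?graph ` ?D \<subseteq> Fpow ?T"
    using U(2) sum_group_nth_closed[OF grp] finite_supp[OF grp] by (fastforce simp: Fpow_def)
  with inj have "|?D| \<le>o |Fpow ?T|" using card_of_ordLeq[of ?D "Fpow ?T"] by blast
  from ordLeq_transitive[OF this Fpow] show ?thesis .
qed

text \<open>Restricting the elements of \<open>S\<close> to \<open>U\<close> cannot be injective, for lack of room in the
  direct sum over \<open>U\<close>. The quotient of two elements with the same restriction does the job.\<close>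

lemma subgroup_nontrivial_avoiding:
  assumes grp: "\<And>i. i \<in> I \<Longrightarrow> group (H i)"
    and S: "subgroup S (sum_group I H)"
    and r: "Cinfinite r" "r <o |S|" and U: "|U| \<le>o r" "U \<subseteq> I"
    and H: "\<And>i. i \<in> U \<Longrightarrow> |carrier (H i)| \<le>o r"
  obtains x where "x \<in> S" "supp I H x \<noteq> {}" "supp I H x \<inter> U = {}"
proof -
  interpret D: group "sum_group I H" using grp by (rule sum_group)
  let ?D = "{x \<in> carrier (sum_group I H). supp I H x \<subseteq> U}"
  let ?res = "\<lambda>x. \<lambda>i\<in>I. if i \<in> U then x i else \<one>\<^bsub>H i\<^esub>"
  have SD: "S \<subseteq> carrier (sum_group I H)" using S by (rule subgroup.subset)
  have one: "\<one>\<^bsub>H i\<^esub> \<in> carrier (H i)" if "i \<in> I" for i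
    using group.is_monoid[OF grp[OF that]] by (rule monoid.one_closed)
  have "?res ` S \<subseteq> ?D"
  proof (rule image_subsetI)
    fix x assume "x \<in> S"
    then have x: "x \<in> carrier (sum_group I H)" using SD by blast
    have "supp I H (?res x) \<subseteq> supp I H x" by (auto simp: supp_def)
    then have "finite (supp I H (?res x))" using finite_supp[OF grp x] by (rule finite_subset)
    moreover have "?res x \<in> (\<Pi>\<^sub>E i\<in>I. carrier (H i))"
      using sum_group_nth_closed[OF grp x] one by auto
    ultimately have "?res x \<in> carrier (sum_group I H)"
      using carrier_sum_group[of I H, OF grp] by (simp add: supp_def)
    moreover have "supp I H (?res x) \<subseteq> U" by (auto simp: supp_def)
    ultimately show "?res x \<in> ?D" by blast
  qed
  moreover have "|?D| <o |S|"
    using card_supported_elements[OF grp r(1) U H] r(2) by (rule ordLeq_ordLess_trans)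
  ultimately have "\<not> inj_on ?res S" using card_of_ordLess[of S ?D] by blast
  then obtain x y where xy: "x \<in> S" "y \<in> S" "x \<noteq> y" and eq: "?res x = ?res y"
    unfolding inj_on_def by blast
  have xD: "x \<in> carrier (sum_group I H)" and yD: "y \<in> carrier (sum_group I H)"
    using xy SD by auto
  let ?z = "x \<otimes>\<^bsub>sum_group I H\<^esub> inv\<^bsub>sum_group I H\<^esub> y"
  have z: "?z i = x i \<otimes>\<^bsub>H i\<^esub> inv\<^bsub>H i\<^esub> y i" if "i \<in> I" for i
    using that by (simp add: inv_sum_group[OF grp yD])
  show ?thesis
  proof (rule that)
    show "?z \<in> S" using xy by (intro subgroup.m_closed[OF S] subgroup.m_inv_closed[OF S])
    have "?z i = \<one>\<^bsub>H i\<^esub>" if "i \<in> I" "i \<in> U" for i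
    proof -
      have "x i = y i" using fun_cong[OF eq, of i] that by simp
      then show ?thesis
        using z[OF that(1)] group.r_inv[OF grp sum_group_nth_closed[OF grp yD]] that(1) by simp
    qed
    then show "supp I H ?z \<inter> U = {}" unfolding supp_def by auto
    obtain i where i: "i \<in> I" "x i \<noteq> y i" using sum_group_eqI[OF grp xD yD] xy(3) by blast
    interpret Hi: group "H i" by (rule grp[OF i(1)])
    have "?z i \<noteq> \<one>\<^bsub>H i\<^esub>"
      using z[OF i(1)] i sum_group_nth_closed[OF grp xD i(1)] sum_group_nth_closed[OF grp yD i(1)]
        Hi.inv_equality[of "x i" "inv\<^bsub>H i\<^esub> y i"] by auto
    then show "supp I H ?z \<noteq> {}" using i(1) unfolding supp_def by blast
  qed
qed

text \<open>Each further factor is chosen to avoid \<open>U\<close> together with the support of the product built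
  so far; this set is still bounded by \<open>r\<close>, and disjointness of the supports makes them add up.\<close>

lemma subgroup_large_supp_avoiding:
  assumes grp: "\<And>i. i \<in> I \<Longrightarrow> group (H i)"
    and S: "subgroup S (sum_group I H)"
    and r: "Cinfinite r" "r <o |S|" and H: "\<And>i. i \<in> I \<Longrightarrow> |carrier (H i)| \<le>o r"
    and U: "|U| \<le>o r" "U \<subseteq> I"
  shows "\<exists>x\<in>S. n \<le> card (supp I H x) \<and> supp I H x \<inter> U = {}"
proof (induction n)
  case 0
  have "supp I H \<one>\<^bsub>sum_group I H\<^esub> = {}" by (auto simp: supp_def)
  then show ?case using subgroup.one_closed[OF S] by (metis inf_bot_left le0)
next
  case (Suc n)
  then obtain x where x: "x \<in> S" "n \<le> card (supp I H x)" "supp I H x \<inter> U = {}" by blast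
  have SD: "S \<subseteq> carrier (sum_group I H)" using S by (rule subgroup.subset)
  have fin: "finite (supp I H y)" if "y \<in> S" for y
    using SD that by (intro finite_supp grp) auto
  have "|U \<union> supp I H x| \<le>o r"
    using U(1) finite_ordLeq_Cinfinite[OF fin[OF x(1)] r(1)] r(1) by (rule Un_Cinfinite_bound)
  moreover have "U \<union> supp I H x \<subseteq> I" using U(2) by (auto simp: supp_def)
  ultimately obtain y where y: "y \<in> S" "supp I H y \<noteq> {}"
    "supp I H y \<inter> (U \<union> supp I H x) = {}"
    using subgroup_nontrivial_avoiding[OF grp S r, of "U \<union> supp I H x"] H by blast
  have xy: "supp I H (x \<otimes>\<^bsub>sum_group I H\<^esub> y) = supp I H x \<union> supp I H y"
    using x(1) y(1,3) SD by (intro supp_mult_disjoint[OF grp]) auto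
  have "card (supp I H x \<union> supp I H y) = card (supp I H x) + card (supp I H y)"
    using fin x(1) y(1,3) by (intro card_Un_disjoint) auto
  moreover have "0 < card (supp I H y)" using fin[OF y(1)] y(2) by (simp add: card_gt_0_iff)
  ultimately have "Suc n \<le> card (supp I H (x \<otimes>\<^bsub>sum_group I H\<^esub> y))" using x(2) xy by simp
  moreover have "supp I H (x \<otimes>\<^bsub>sum_group I H\<^esub> y) \<inter> U = {}" using xy x(3) y(3) by blast
  ultimately show ?case using subgroup.m_closed[OF S x(1) y(1)] by blast
qed

section \<open>Covering by sets of bounded support\<close>

text \<open>The whole subgroup always covers, so the content is the lower bound: fewer than \<open>|S|\<close>
  translates of \<open>A A\<inverse>\<close> miss every element of large support that avoids the supports of the
  translating elements.\<close>

lemma cov_bounded_supp: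
  assumes grp: "\<And>i. i \<in> I \<Longrightarrow> group (H i)"
    and S: "subgroup S (sum_group I H)"
    and G: "G = (sum_group I H)\<lparr>carrier := S\<rparr>"
    and l: "Cinfinite l" "l <o |S|" and H: "\<And>i. i \<in> I \<Longrightarrow> |carrier (H i)| \<le>o l"
    and A: "A \<noteq> {}" "A \<subseteq> S" "\<And>a. a \<in> A \<Longrightarrow> card (supp I H a) \<le> m"
  shows "cov G (A <#>\<^bsub>G\<^esub> set_inv\<^bsub>G\<^esub> A) =o |S|"
proof -
  interpret D: group "sum_group I H" using grp by (rule sum_group)
  have SD: "S \<subseteq> carrier (sum_group I H)" using S by (rule subgroup.subset)
  have fin: "finite (supp I H y)" if "y \<in> S" for y
    using SD that by (intro finite_supp grp) auto
  have group: "group G" unfolding G using S D.is_group by (rule subgroup.subgroup_is_group)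
  have carrier: "carrier G = S" and mult: "x \<otimes>\<^bsub>G\<^esub> y = x \<otimes>\<^bsub>sum_group I H\<^esub> y" for x y
    by (simp_all add: G)
  have inv: "inv\<^bsub>G\<^esub> x = inv\<^bsub>sum_group I H\<^esub> x" if "x \<in> S" for x
    using D.m_inv_consistent[OF S that] by (simp add: G)
  let ?B = "A <#>\<^bsub>G\<^esub> set_inv\<^bsub>G\<^esub> A"
  have B: "?B \<subseteq> carrier G" "?B \<noteq> {}"
  proof -
    have "set_inv\<^bsub>G\<^esub> A \<subseteq> carrier G"
      using group.inv_closed[OF group] A(2) carrier by (auto simp: SET_INV_def)
    with A(2) show "?B \<subseteq> carrier G"
      unfolding carrier[symmetric] by (intro monoid.set_mult_closed[OF group.is_monoid[OF group]])
    show "?B \<noteq> {}" using A(1) by (auto simp: set_mult_def SET_INV_def)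
  qed
  have le: "cov G ?B \<le>o |S|"
    using cov_is_min(2)[OF group B covers_carrier[OF group B]] by (simp add: carrier)
  obtain X where X: "covers G ?B X" "cov G ?B = |X|" using cov_is_min(1)[OF group B] by blast
  have XS: "X \<subseteq> S" using X(1) unfolding covers_def carrier by blast
  have "\<not> |X| <o |S|"
  proof
    assume less: "|X| <o |S|"
    \<comment> \<open>a single infinite cardinal below \<open>|S|\<close> that bounds both \<open>X\<close> and the coordinate groups\<close>
    define r where "r = l +c |X|"
    have infS: "Cinfinite |S|"
      using cinfinite_mono[OF ordLess_imp_ordLeq[OF l(2)]] l(1) by (simp add: card_of_Card_order)
    have r: "Cinfinite r" unfolding r_def using l(1) by (rule Cinfinite_csum1)
    have rS: "r <o |S|"
    proof -
      have "|Field l| <o |S|"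
        using card_of_Field_ordIso l by (blast intro: ordIso_ordLess_trans)
      with less show ?thesis
        unfolding r_def csum_def Field_card_of using infS card_of_Plus_ordLess_infinite_Field[of "|S|"]
        by (simp add: cinfinite_def)
    qed
    have lr: "l \<le>o r" and Xr: "|X| \<le>o r"
      unfolding r_def using l(1) by (auto intro: ordLeq_csum1 ordLeq_csum2 card_of_Card_order)
    define U where "U = (\<Union>x\<in>X. supp I H x)"
    have "|U| \<le>o r" unfolding U_def
      using Xr finite_ordLeq_Cinfinite[OF fin r] XS r by (intro UNION_Cinfinite_bound) auto
    moreover have "U \<subseteq> I" unfolding U_def supp_def by blast
    moreover have "|carrier (H i)| \<le>o r" if "i \<in> I" for i
      using H[OF that] lr by (rule ordLeq_transitive)
    \<comment> \<open>one more than the size that \<open>A A\<inverse>\<close> can reach\<close>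
    ultimately obtain g where g: "g \<in> S" "Suc (2 * m) \<le> card (supp I H g)" "supp I H g \<inter> U = {}"
      using subgroup_large_supp_avoiding[OF grp S r rS] by blast
    from g(1) X(1) have "g \<in> X <#>\<^bsub>G\<^esub> ?B" unfolding covers_def carrier by blast
    then obtain x a b where xab: "x \<in> X" "a \<in> A" "b \<in> A" "g = x \<otimes>\<^bsub>G\<^esub> (a \<otimes>\<^bsub>G\<^esub> inv\<^bsub>G\<^esub> b)"
      by (auto simp: set_mult_def SET_INV_def)
    have bS: "b \<in> S" using xab A(2) by blast
    have "supp I H g \<subseteq> supp I H x \<union> (supp I H a \<union> supp I H (inv\<^bsub>sum_group I H\<^esub> b))"
      using xab(4) supp_mult_subset[of I H, OF grp] unfolding mult inv[OF bS] by blast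
    then have "supp I H g \<subseteq> supp I H a \<union> supp I H b"
      using xab(1) g(3) supp_inv[of I H b, OF grp] bS SD unfolding U_def by blast
    then have "card (supp I H g) \<le> card (supp I H a \<union> supp I H b)"
      using xab A(2) fin by (intro card_mono) auto
    also have "\<dots> \<le> card (supp I H a) + card (supp I H b)" by (rule card_Un_le)
    also have "\<dots> \<le> 2 * m" using A(3)[OF xab(2)] A(3)[OF xab(3)] by simp
    finally show False using g(2) by simp
  qed
  then have "|S| \<le>o cov G ?B" using X(2) by (simp add: not_ordLess_iff_ordLeq)
  with le show ?thesis by (simp add: ordIso_iff_ordLeq)
qed

theorem theorem2:
  fixes l :: "'l rel" and k :: "'k rel"
    and H :: "'k \<Rightarrow> ('h, 'm) monoid_scheme"
    and S :: "('k \<Rightarrow> 'h) set"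
    and G :: "('k \<Rightarrow> 'h) monoid"
  assumes "Cinfinite l" and "Cinfinite k" and "l <o k"
    and "\<And>\<alpha>. \<alpha> \<in> Field k \<Longrightarrow> group (H \<alpha>)"
    and "\<And>\<alpha>. \<alpha> \<in> Field k \<Longrightarrow> |carrier (H \<alpha>)| \<le>o l"
    and "subgroup S (sum_group (Field k) H)"
    and "G = (sum_group (Field k) H)\<lparr>carrier := S\<rparr>"
    and "|carrier G| =o k"
  shows "\<exists>A :: nat \<Rightarrow> ('k \<Rightarrow> 'h) set.
           (\<forall>n. A n \<noteq> {}) \<and> disjoint_family A \<and> (\<Union>n. A n) = carrier G \<and>
           (\<forall>n. cov G (A n <#>\<^bsub>G\<^esub> set_inv\<^bsub>G\<^esub> (A n)) =o k)"
proof -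
  let ?I = "Field k"
  have carrier: "carrier G = S" by (simp add: assms(7))
  with assms(8) have Sk: "|S| =o k" by simp
  have lS: "l <o |S|" using assms(3) ordIso_symmetric[OF Sk] by (rule ordLess_ordIso_trans)
  define size where "size = (\<lambda>x. card (supp ?I H x))"
  have inf: "infinite (size ` S)"
    unfolding infinite_nat_iff_unbounded_le
  proof
    fix n
    show "\<exists>m\<ge>n. m \<in> size ` S"
      using subgroup_large_supp_avoiding[OF assms(4,6,1) lS assms(5), where U = "{}" and n = n]
        finite_ordLeq_Cinfinite[OF finite.emptyI assms(1)]
      unfolding size_def by blast
  qed
  define A where "A = (\<lambda>n. {x \<in> S. size x = enumerate (size ` S) n})"
  have "A n \<noteq> {}" for n
    using enumerate_in_set[OF inf, of n] unfolding A_def by auto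
  moreover have "disjoint_family A"
    unfolding disjoint_family_on_def A_def
    using strict_mono_enumerate[OF inf] by (auto simp: strict_mono_eq)
  moreover have "(\<Union>n. A n) = carrier G"
    unfolding A_def carrier using range_enumerate[OF inf] by auto
  moreover have "cov G (A n <#>\<^bsub>G\<^esub> set_inv\<^bsub>G\<^esub> (A n)) =o k" for n
  proof -
    have "cov G (A n <#>\<^bsub>G\<^esub> set_inv\<^bsub>G\<^esub> (A n)) =o |S|"
      by (rule cov_bounded_supp[OF assms(4,6,7,1) lS assms(5), where m = "enumerate (size ` S) n"])
        (use \<open>A n \<noteq> {}\<close> in \<open>auto simp: A_def size_def\<close>)
    then show ?thesis using Sk by (rule ordIso_transitive)
  qed
  ultimately show ?thesis by blast
qed

end
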